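(* Let $X$ be a real Banach space and let $F$ be a norming subspace of $X^*$. Write $\sigma$ for the topology $\sigma(X,F)$ on $X$. The following statements are equivalent: (a) Every $\sigma$-closed, (norm-)bounded convex set in $X$ is the $\sigma$-closed convex hull of its farthest points, i.e. $K = \overline{\mathrm{co}}^{\,\sigma}(b(K))$ for every such set $K$. (b) (i) $X$ has the $F$-MIP, and (ii) every $\sigma$-closed, (norm-)bounded convex set in $X$ has the Property $(R)$.
   Context: All Banach spaces are real, and all sets $K$ considered are nonempty. A subspace $F$ of $X^*$ is norming if $\|x\| = \sup\{f(x) : f\in F,\ \|f\|\le 1\}$ for all $x\in X$. The topology $\sigma = \sigma(X,F)$ is the weakest topology on $X$ making every $f\in F$ continuous; $\overline{\mathrm{co}}^{\,\sigma}(A)$ denotes the $\sigma$-closure of the convex hull of $A$. (Every $\sigma$-closed set is norm closed.) For a norm-closed and bounded set $K\subseteq X$ and $x\in X$: - $r_K(x) = \sup\{\|z-x\| : z\in K\}$ (farthest distance map); - $Q_K(x) = \{z\in K : \|z-x\| = r_K(x)\}$; - $D(K) = \{x\in X : Q_K(x)\neq\emptyset\}$; - $b(K) = \bigcup\{Q_K(x) : x\in D(K)\}$ is the set of farthest points of $K$; - for $\alpha>0$, $C(K,x,\alpha) = \{z\in K : \|z-x\| > r_K(x)-\alpha\}$ is the crescent of $K$ determined by $x$ and $\alpha$. $K$ has the Property $(R)$ if every crescent $C(K,x,\alpha)$ ($x\in X$, $\alpha>0$) of $K$ contains a farthest point of $K$, i.e. meets $b(K)$. A set in $X$ is admissible if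 it is the intersection of all closed (norm) balls of $X$ containing it. $X$ has the $F$-MIP if every bounded, $\sigma$-closed convex set in $X$ is admissible. *)

theory Defs
  imports "HOL-Analysis.Analysis"
begin

definition norming :: "('a::real_normed_vector \<Rightarrow>\<^sub>L real) set \<Rightarrow> bool" where
  "norming F \<longleftrightarrow> (\<forall>x. norm x = Sup {blinfun_apply f x |f. f \<in> F \<and> norm f \<le> 1})"

definition sigma_top :: "('a::real_normed_vector \<Rightarrow>\<^sub>L real) set \<Rightarrow> 'a topology" where
  "sigma_top F = topology_generated_by {blinfun_apply f -` U |f U. f \<in> F \<and> open U}"

text \<open>The next three facts confirm that \<open>sigma_top F\<close> is the weakest topology on the
  whole space for which every member of \<open>F\<close> is continuous.\<close>

lemma topspace_sigma_top:
  assumes "F \<noteq> {}"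
  shows "topspace (sigma_top F) = UNIV"
proof -
  obtain f where "f \<in> F" using assms by blast
  then have "blinfun_apply f -` UNIV \<in> {blinfun_apply f -` U |f U. f \<in> F \<and> open U}"
    using open_UNIV by blast
  then show ?thesis
    unfolding sigma_top_def topology_generated_by_topspace by auto
qed

lemma continuous_map_sigma_top:
  assumes "f \<in> F"
  shows "continuous_map (sigma_top F) euclideanreal (blinfun_apply f)"
proof -
  have "topspace (sigma_top F) = UNIV"
    using assms by (intro topspace_sigma_top) auto
  moreover have "openin (sigma_top F) (blinfun_apply f -` U)" if "open U" for U
    unfolding sigma_top_def using assms that by (intro topology_generated_by_Basis) auto
  ultimately show ?thesis
    by (auto simp: continuous_map_def vimage_def)
qed

lemma sigma_top_weakest:
  assumes "topspace T = UNIV"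
    and "\<And>f. f \<in> F \<Longrightarrow> continuous_map T euclideanreal (blinfun_apply f)"
    and "openin (sigma_top F) U"
  shows "openin T U"
proof -
  have "openin T (blinfun_apply f -` V)" if "f \<in> F" "open V" for f V
    using assms(2)[OF that(1)] that(2) assms(1) by (auto simp: continuous_map_def vimage_def)
  then have basis: "openin T W" if "W \<in> {blinfun_apply f -` U |f U. f \<in> F \<and> open U}" for W
    using that by auto
  have "generate_topology_on {blinfun_apply f -` U |f U. f \<in> F \<and> open U} U"
    using assms(3) by (simp add: sigma_top_def openin_topology_generated_by_iff)
  then show ?thesis
    by (induction rule: generate_topology_on.induct) (use basis in auto)
qed

definition farthest_dist :: "'a::real_normed_vector set \<Rightarrow> 'a \<Rightarrow> real" where
  "farthest_dist K x = (SUP z\<in>K. norm (z - x))"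

definition farthest_set :: "'a::real_normed_vector set \<Rightarrow> 'a \<Rightarrow> 'a set" where
  "farthest_set K x = {z \<in> K. norm (z - x) = farthest_dist K x}"

definition farthest_dom :: "'a::real_normed_vector set \<Rightarrow> 'a set" where
  "farthest_dom K = {x. farthest_set K x \<noteq> {}}"

definition farthest_points :: "'a::real_normed_vector set \<Rightarrow> 'a set" where
  "farthest_points K = (\<Union>x\<in>farthest_dom K. farthest_set K x)"

definition crescent :: "'a::real_normed_vector set \<Rightarrow> 'a \<Rightarrow> real \<Rightarrow> 'a set" where
  "crescent K x \<alpha> = {z \<in> K. norm (z - x) > farthest_dist K x - \<alpha>}"

definition property_R :: "'a::real_normed_vector set \<Rightarrow> bool" where
  "property_R K \<longleftrightarrow> (\<forall>x. \<forall>\<alpha>>0. crescent K x \<alpha> \<inter> farthest_points K \<noteq> {})"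

definition admissible_set :: "'a::real_normed_vector set \<Rightarrow> bool" where
  "admissible_set K \<longleftrightarrow> K = \<Inter>{B. (\<exists>c r. B = cball c r) \<and> K \<subseteq> B}"

text \<open>All sets considered are nonempty; in particular the empty set is not an instance of
  the class of sets below.\<close>

definition sigma_cbc :: "('a::real_normed_vector \<Rightarrow>\<^sub>L real) set \<Rightarrow> 'a set \<Rightarrow> bool" where
  "sigma_cbc F K \<longleftrightarrow> K \<noteq> {} \<and> closedin (sigma_top F) K \<and> bounded K \<and> convex K"

definition has_MIP :: "('a::real_normed_vector \<Rightarrow>\<^sub>L real) set \<Rightarrow> bool" where
  "has_MIP F \<longleftrightarrow> (\<forall>K. sigma_cbc F K \<longrightarrow> admissible_set K)"

end

theory Submission imports Defs begin

text \<open>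
  Balls are \<open>\<sigma>\<close>-closed because \<open>F\<close> is norming. Hence if a crescent of \<open>K\<close> misses the farthest
  points, these lie in a smaller ball, which then contains their \<open>\<sigma>\<close>-closed hull; so (a) implies
  property (R). Conversely, under (b), a point of \<open>K\<close> outside the hull of the farthest points is cut
  off by a ball, and the corresponding crescent contains no farthest point.

  For (a) implies the MIP, suppose \<open>x\<^sub>0 \<notin> K\<close> lies in every ball containing \<open>K\<close>, and separate
  \<open>x\<^sub>0\<close> strictly from the \<open>\<epsilon>\<close>-enlargement of \<open>K\<close> by some \<open>f \<in> F\<close>. Let \<open>L\<close> be the \<open>\<sigma>\<close>-closed convex
  hull of the enlargement and \<open>x\<^sub>0\<close>. For each \<open>x\<close> the enlargement has farthest distance at least
  \<open>r\<^sub>K(x) + \<epsilon>\<close>, whereas \<open>x\<^sub>0\<close> has distance at most \<open>r\<^sub>K(x)\<close>. This gap forces every farthest point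
  of \<open>L\<close> to the side of \<open>f\<close> away from \<open>x\<^sub>0\<close>, so \<open>L\<close> is not the closed hull of its farthest points.
\<close>

section \<open>Basic neighbourhoods, closure and convexity in the topology \<sigma>\<close>

text \<open>By induction over the generation of open sets: an intersection is handled by the union
  of the two finite families and the smaller of the two radii, a union by any member containing
  \<open>x\<close>.\<close>

lemma sigma_top_basic_nhd:
  assumes "F \<noteq> {}" "openin (sigma_top F) U" "x \<in> U"
  obtains G d where "finite G" "G \<subseteq> F" "d > 0"
    "{y. \<forall>f\<in>G. \<bar>blinfun_apply f (y - x)\<bar> < d} \<subseteq> U"
proof -
  have "generate_topology_on {blinfun_apply f -` U |f U. f \<in> F \<and> open U} U"
    using assms(2) by (simp add: sigma_top_def openin_topology_generated_by_iff)
  then have "x \<in> U \<Longrightarrow> \<exists>G d. finite G \<and> G \<subseteq> F \<and> d > 0 \<and>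
      {y. \<forall>f\<in>G. \<bar>blinfun_apply f (y - x)\<bar> < d} \<subseteq> U"
  proof (induction rule: generate_topology_on.induct)
    case Empty
    then show ?case by (simp only: empty_iff)
  next
    case (Int a b)
    then have x: "x \<in> a" "x \<in> b" by (simp_all only: Int_iff)
    from Int.IH(1)[OF x(1)] obtain G d where G: "finite G" "G \<subseteq> F" "d > 0"
      "{y. \<forall>f\<in>G. \<bar>blinfun_apply f (y - x)\<bar> < d} \<subseteq> a" by (elim exE conjE)
    from Int.IH(2)[OF x(2)] obtain H e where H: "finite H" "H \<subseteq> F" "e > 0"
      "{y. \<forall>f\<in>H. \<bar>blinfun_apply f (y - x)\<bar> < e} \<subseteq> b" by (elim exE conjE)
    have "{y. \<forall>f\<in>G \<union> H. \<bar>blinfun_apply f (y - x)\<bar> < min d e} \<subseteq> a \<inter> b"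
    proof
      fix y assume "y \<in> {y. \<forall>f\<in>G \<union> H. \<bar>blinfun_apply f (y - x)\<bar> < min d e}"
      then have "y \<in> {y. \<forall>f\<in>G. \<bar>blinfun_apply f (y - x)\<bar> < d}"
        "y \<in> {y. \<forall>f\<in>H. \<bar>blinfun_apply f (y - x)\<bar> < e}" by simp_all
      then show "y \<in> a \<inter> b" using G(4) H(4) by blast
    qed
    moreover have "finite (G \<union> H)" "G \<union> H \<subseteq> F" "min d e > 0"
      using G(1-3) H(1-3) by simp_all
    ultimately show ?case by (intro exI conjI)
  next
    case (UN K)
    then obtain k where k: "k \<in> K" "x \<in> k" by (elim UnionE)
    from UN.IH[OF k] obtain G d where G: "finite G" "G \<subseteq> F" "d > 0"
      "{y. \<forall>f\<in>G. \<bar>blinfun_apply f (y - x)\<bar> < d} \<subseteq> k" by (elim exE conjE)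
    from G(4) Union_upper[OF k(1)]
    have "{y. \<forall>f\<in>G. \<bar>blinfun_apply f (y - x)\<bar> < d} \<subseteq> \<Union>K" by (rule order_trans)
    with G(1-3) show ?case by (intro exI conjI)
  next
    case (Basis s)
    then obtain f V where f: "f \<in> F" "open V" "s = blinfun_apply f -` V" by blast
    then have "blinfun_apply f x \<in> V" using Basis.prems by simp
    then obtain e where e: "e > 0" "\<And>r. \<bar>r - blinfun_apply f x\<bar> < e \<Longrightarrow> r \<in> V"
      using f(2) unfolding open_dist dist_real_def by blast
    have "{y. \<forall>f\<in>{f}. \<bar>blinfun_apply f (y - x)\<bar> < e} \<subseteq> s"
      using e(2) by (simp add: f(3) blinfun.diff_right subset_iff)
    then show ?case using e(1) f(1) by (intro exI[of _ "{f}"] exI[of _ e]) simp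
  qed
  from this[OF assms(3)] show thesis
    by (elim exE conjE) (rule that)
qed

lemma openin_sigma_top_basic_nhd:
  assumes "F \<noteq> {}" "finite G" "G \<subseteq> F"
  shows "openin (sigma_top F) {y. \<forall>f\<in>G. \<bar>blinfun_apply f (y - x)\<bar> < d}"
  using assms(2,3)
proof (induction G rule: finite_induct)
  case empty
  then show ?case
    using openin_topspace[of "sigma_top F"] topspace_sigma_top[OF assms(1)] by simp
next
  case (insert g G)
  have eq: "{y. \<forall>f\<in>insert g G. \<bar>blinfun_apply f (y - x)\<bar> < d} =
     blinfun_apply g -` ball (blinfun_apply g x) d \<inter> {y. \<forall>f\<in>G. \<bar>blinfun_apply f (y - x)\<bar> < d}"
    by (auto simp: dist_real_def blinfun.diff_right abs_minus_commute)
  have "openin (sigma_top F) (blinfun_apply g -` ball (blinfun_apply g x) d)"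
    unfolding sigma_top_def using insert by (intro topology_generated_by_Basis) auto
  then show ?case
    unfolding eq by (rule openin_Int) (use insert in simp)
qed

text \<open>Basic neighbourhoods turn closure membership into simultaneous approximation on finitely
  many functionals, a form in which linearity can be used.\<close>

lemma in_sigma_closure_iff:
  assumes "F \<noteq> {}"
  shows "x \<in> sigma_top F closure_of C \<longleftrightarrow>
    (\<forall>G d. finite G \<and> G \<subseteq> F \<and> d > 0 \<longrightarrow> (\<exists>y\<in>C. \<forall>f\<in>G. \<bar>blinfun_apply f (y - x)\<bar> < d))"
    (is "_ \<longleftrightarrow> ?R")
proof
  assume x: "x \<in> sigma_top F closure_of C"
  show ?R
  proof (intro allI impI)
    fix G and d :: real
    assume G: "finite G \<and> G \<subseteq> F \<and> d > 0"
    let ?U = "{y. \<forall>f\<in>G. \<bar>blinfun_apply f (y - x)\<bar> < d}"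
    have "x \<in> ?U" "openin (sigma_top F) ?U"
      using G openin_sigma_top_basic_nhd[OF assms] by simp_all
    then have "\<exists>y. y \<in> C \<and> y \<in> ?U"
      using x[unfolded in_closure_of, THEN conjunct2, rule_format] by (simp only: simp_thms)
    then show "\<exists>y\<in>C. \<forall>f\<in>G. \<bar>blinfun_apply f (y - x)\<bar> < d" by blast
  qed
next
  assume R: ?R
  have "\<exists>y. y \<in> C \<and> y \<in> T" if T: "x \<in> T" "openin (sigma_top F) T" for T
  proof -
    from sigma_top_basic_nhd[OF assms T(2,1)] obtain G d where
      "finite G" "G \<subseteq> F" "d > 0" "{y. \<forall>f\<in>G. \<bar>blinfun_apply f (y - x)\<bar> < d} \<subseteq> T" .
    moreover from this(1-3) have "\<exists>y\<in>C. \<forall>f\<in>G. \<bar>blinfun_apply f (y - x)\<bar> < d"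
      using R by simp
    ultimately show ?thesis by blast
  qed
  then show "x \<in> sigma_top F closure_of C"
    by (auto simp: in_closure_of topspace_sigma_top[OF assms])
qed

text \<open>Approximate both points for the same \<open>G\<close> and \<open>d\<close>; each
  functional in \<open>G\<close> is linear, so the error at the convex combination is again below
  \<open>d\<close>.\<close>

lemma convex_sigma_closure:
  assumes "F \<noteq> {}" "convex C"
  shows "convex (sigma_top F closure_of C)"
proof (rule convexI)
  fix x y and u v :: real
  assume x: "x \<in> sigma_top F closure_of C" and y: "y \<in> sigma_top F closure_of C"
    and uv: "0 \<le> u" "0 \<le> v" "u + v = 1"
  show "u *\<^sub>R x + v *\<^sub>R y \<in> sigma_top F closure_of C"
    unfolding in_sigma_closure_iff[OF assms(1)]
  proof (intro allI impI)
    fix G and d :: real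
    assume G: "finite G \<and> G \<subseteq> F \<and> d > 0"
    obtain a where a: "a \<in> C" "\<And>f. f \<in> G \<Longrightarrow> \<bar>blinfun_apply f (a - x)\<bar> < d"
      using in_sigma_closure_iff[OF assms(1), THEN iffD1, rule_format, OF x G] by (elim bexE) simp
    obtain b where b: "b \<in> C" "\<And>f. f \<in> G \<Longrightarrow> \<bar>blinfun_apply f (b - y)\<bar> < d"
      using in_sigma_closure_iff[OF assms(1), THEN iffD1, rule_format, OF y G] by (elim bexE) simp
    have "\<bar>blinfun_apply f (u *\<^sub>R a + v *\<^sub>R b - (u *\<^sub>R x + v *\<^sub>R y))\<bar> < d" if "f \<in> G" for f
    proof -
      have "blinfun_apply f (u *\<^sub>R a + v *\<^sub>R b - (u *\<^sub>R x + v *\<^sub>R y))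
          = u * blinfun_apply f (a - x) + v * blinfun_apply f (b - y)"
        by (simp add: blinfun.bilinear_simps algebra_simps)
      then show ?thesis
        using convex_bound_lt[OF a(2)[OF that] b(2)[OF that] uv] uv
          abs_triangle_ineq[of "u * blinfun_apply f (a - x)" "v * blinfun_apply f (b - y)"]
        by (simp add: abs_mult)
    qed
    moreover have "u *\<^sub>R a + v *\<^sub>R b \<in> C"
      using convexD[OF assms(2) a(1) b(1) uv] .
    ultimately show "\<exists>z\<in>C. \<forall>f\<in>G. \<bar>blinfun_apply f (z - (u *\<^sub>R x + v *\<^sub>R y))\<bar> < d"
      by (intro bexI ballI)
  qed
qed

lemma closedin_sigma_top_halfspace:
  assumes "f \<in> F"
  shows "closedin (sigma_top F) {y. blinfun_apply f y \<le> c}"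
proof -
  have "closedin (sigma_top F) {y \<in> topspace (sigma_top F). blinfun_apply f y \<in> {..c}}"
    by (intro closedin_continuous_map_preimage[OF continuous_map_sigma_top[OF assms]]) simp
  moreover have "topspace (sigma_top F) = UNIV"
    using assms by (intro topspace_sigma_top) auto
  ultimately show ?thesis by simp
qed

section \<open>Norming subspaces and \<sigma>-closed sublevel sets\<close>

lemma norming_norm_le:
  assumes "subspace F" "norming F"
    and "\<And>f. f \<in> F \<Longrightarrow> norm f \<le> 1 \<Longrightarrow> blinfun_apply f x \<le> r"
  shows "norm x \<le> r"
proof -
  have "norm x = Sup {blinfun_apply f x |f. f \<in> F \<and> norm f \<le> 1}"
    using assms(2) by (simp add: norming_def)
  also have "\<dots> \<le> r"
  proof (rule cSup_least)
    have "0 \<in> F \<and> norm (0 :: 'a \<Rightarrow>\<^sub>L real) \<le> 1"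
      using assms(1) by (simp add: subspace_0)
    then show "{blinfun_apply f x |f. f \<in> F \<and> norm f \<le> 1} \<noteq> {}" by blast
  qed (use assms(3) in auto)
  finally show ?thesis .
qed

lemma blinfun_apply_le_norm:
  fixes f :: "'a::real_normed_vector \<Rightarrow>\<^sub>L real"
  shows "blinfun_apply f x \<le> norm f * norm x"
  using norm_blinfun[of f x] by simp

text \<open>The norm is a supremum of functionals \<open>h\<close> from the unit ball of
  \<open>F\<close>, so the set is an intersection of half-spaces given by \<open>h + f\<close>,
  again in \<open>F\<close>. The case \<open>f = 0\<close> yields balls; multiples of a separating
  functional yield the set that traps \<open>L\<close> in the proof of admissibility.\<close>

lemma closedin_sigma_top_norm_plus_sublevel:
  assumes "subspace F" "norming F" "f \<in> F"
  shows "closedin (sigma_top F) {y. norm (y - x) + blinfun_apply f y \<le> c}"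
proof -
  define H where "H = {h \<in> F. norm h \<le> 1}"
  have "0 \<in> H" using assms(1) by (simp add: H_def subspace_0)
  have "{y. norm (y - x) + blinfun_apply f y \<le> c} =
     (\<Inter>h\<in>H. {y. blinfun_apply (h + f) y \<le> c + blinfun_apply h x})"
  proof (intro set_eqI iffI)
    fix y assume y: "y \<in> {y. norm (y - x) + blinfun_apply f y \<le> c}"
    have "blinfun_apply (h + f) y \<le> c + blinfun_apply h x" if "h \<in> H" for h
    proof -
      have "norm h \<le> 1" using that by (simp add: H_def)
      then have "blinfun_apply h (y - x) \<le> norm (y - x)"
        using blinfun_apply_le_norm[of h "y - x"] mult_right_mono[of "norm h" 1 "norm (y - x)"]
        by simp
      then show ?thesis
        using y by (simp add: blinfun.bilinear_simps)
    qed
    then show "y \<in> (\<Inter>h\<in>H. {y. blinfun_apply (h + f) y \<le> c + blinfun_apply h x})"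
      by simp
  next
    fix y assume y: "y \<in> (\<Inter>h\<in>H. {y. blinfun_apply (h + f) y \<le> c + blinfun_apply h x})"
    have "norm (y - x) \<le> c - blinfun_apply f y"
    proof (rule norming_norm_le[OF assms(1,2)])
      fix h assume "h \<in> F" "norm h \<le> 1"
      then have "blinfun_apply (h + f) y \<le> c + blinfun_apply h x"
        using y by (auto simp: H_def)
      then show "blinfun_apply h (y - x) \<le> c - blinfun_apply f y"
        by (simp add: blinfun.bilinear_simps)
    qed
    then show "y \<in> {y. norm (y - x) + blinfun_apply f y \<le> c}" by simp
  qed
  moreover have "closedin (sigma_top F) {y. blinfun_apply (h + f) y \<le> c + blinfun_apply h x}"
    if "h \<in> H" for h
    using that assms(1,3) by (intro closedin_sigma_top_halfspace) (auto simp: H_def subspace_add)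
  ultimately show ?thesis
    using \<open>0 \<in> H\<close> by (auto intro!: closedin_INT)
qed

lemma closedin_sigma_top_cball:
  assumes "subspace F" "norming F"
  shows "closedin (sigma_top F) (cball x r)"
proof -
  have "cball x r = {y. norm (y - x) + blinfun_apply 0 y \<le> r}"
    by (auto simp: dist_norm norm_minus_commute)
  then show ?thesis
    using closedin_sigma_top_norm_plus_sublevel[OF assms subspace_0[OF assms(1)], of x r] by simp
qed

lemma convex_norm_plus_sublevel:
  "convex {y. norm (y - x) + blinfun_apply f y \<le> (c::real)}"
proof -
  have cvx: "convex_on UNIV (\<lambda>y. norm (y - x) + blinfun_apply f y)"
  proof (rule convex_on_add)
    show "convex_on UNIV (\<lambda>y. norm (y - x))"
      using convex_on_dist[of UNIV x] by (simp add: dist_norm norm_minus_commute)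
    show "convex_on UNIV (blinfun_apply f)"
      by (intro convex_onI) (auto simp: blinfun.add_right blinfun.scaleR_right)
  qed
  show ?thesis
  proof (rule convexI)
    fix y z and u v :: real
    assume y: "y \<in> {y. norm (y - x) + blinfun_apply f y \<le> c}"
      and z: "z \<in> {y. norm (y - x) + blinfun_apply f y \<le> c}"
      and uv: "0 \<le> u" "0 \<le> v" "u + v = 1"
    have "norm (u *\<^sub>R y + v *\<^sub>R z - x) + blinfun_apply f (u *\<^sub>R y + v *\<^sub>R z)
        \<le> u * (norm (y - x) + blinfun_apply f y) + v * (norm (z - x) + blinfun_apply f z)"
      using cvx uv by (simp add: convex_on_def)
    also have "\<dots> \<le> c"
      using y z uv by (intro convex_bound_le) simp_all
    finally show "u *\<^sub>R y + v *\<^sub>R z \<in> {y. norm (y - x) + blinfun_apply f y \<le> c}"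
      by simp
  qed
qed

section \<open>The \<sigma>-closed convex hull\<close>

lemma sigma_closed_hull_minimal:
  assumes "S \<subseteq> C" "convex C" "closedin (sigma_top F) C"
  shows "sigma_top F closure_of (convex hull S) \<subseteq> C"
  using assms by (intro closure_of_minimal hull_minimal)

lemma subset_sigma_closed_hull:
  assumes "F \<noteq> {}"
  shows "S \<subseteq> sigma_top F closure_of (convex hull S)"
  using closure_of_subset[of "convex hull S" "sigma_top F"] hull_subset[of S convex]
  by (auto simp: topspace_sigma_top[OF assms])

text \<open>The hull stays bounded because a ball around \<open>S\<close> is convex and,
  \<open>F\<close> being norming, \<sigma>-closed.\<close>

lemma sigma_cbc_closed_hull:
  assumes "subspace F" "norming F" "bounded S" "S \<noteq> {}"
  shows "sigma_cbc F (sigma_top F closure_of (convex hull S))"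
proof -
  have F: "F \<noteq> {}" using assms(1) subspace_0 by blast
  obtain c r where "S \<subseteq> cball c r"
    using assms(3) bounded_subset_cball by blast
  then have "sigma_top F closure_of (convex hull S) \<subseteq> cball c r"
    by (intro sigma_closed_hull_minimal closedin_sigma_top_cball assms) auto
  then show ?thesis
    using subset_sigma_closed_hull[OF F, of S] assms(4) convex_sigma_closure[OF F, of "convex hull S"]
      bounded_subset[OF bounded_cball]
    by (auto simp: sigma_cbc_def)
qed

section \<open>Strict separation of a point by a functional in F\<close>

text \<open>
  The functional is \<open>y \<mapsto> - \<Sum>\<^bsub>f\<in>G\<^esub> f (k - x) * f y\<close>, for a finite \<open>G \<subseteq> F\<close> that keeps \<open>x\<close> away
  from \<open>K\<close> and an almost minimiser \<open>k\<close> of \<open>q y = \<Sum>\<^bsub>f\<in>G\<^esub> (f (y - x))\<^sup>2\<close> on \<open>K\<close>; since \<open>K\<close> is bounded,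
  no exact minimiser is needed.
\<close>

lemma sigma_separation:
  fixes F :: "('a::real_normed_vector \<Rightarrow>\<^sub>L real) set"
  assumes "subspace F" "sigma_cbc F K" "x \<notin> K"
  obtains f \<gamma> where "f \<in> F" "\<gamma> > 0" "\<And>y. y \<in> K \<Longrightarrow> blinfun_apply f y + \<gamma> \<le> blinfun_apply f x"
proof -
  have F: "F \<noteq> {}" using assms(1) subspace_0 by blast
  have K: "K \<noteq> {}" "closedin (sigma_top F) K" "bounded K" "convex K"
    using assms(2) by (auto simp: sigma_cbc_def)
  have "x \<in> - K" using assms(3) by simp
  have "openin (sigma_top F) (- K)"
    using K(2) topspace_sigma_top[OF F] by (simp add: closedin_def Compl_eq_Diff_UNIV)
  from sigma_top_basic_nhd[OF F this \<open>x \<in> - K\<close>] obtain G d where G: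
    "finite G" "G \<subseteq> F" "d > 0" "{y. \<forall>f\<in>G. \<bar>blinfun_apply f (y - x)\<bar> < d} \<subseteq> - K" .
  \<comment> \<open>A positive semidefinite symmetric bilinear form with
    \<open>q y = B (y - x) (y - x)\<close>; \<open>m\<close> is the infimum of \<open>q\<close> on
    \<open>K\<close>.\<close>
  define B where "B u v = (\<Sum>f\<in>G. blinfun_apply f u * blinfun_apply f v)" for u v
  define m where "m = (INF y\<in>K. B (y - x) (y - x))"
  have B_add: "B (u + v) w = B u w + B v w" for u v w
    by (simp add: B_def blinfun.add_right distrib_right sum.distrib)
  have B_scale: "B (c *\<^sub>R u) w = c * B u w" for c u w
    by (simp add: B_def blinfun.scaleR_right sum_distrib_left mult.assoc)
  have B_sym: "B u v = B v u" for u v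
    by (simp add: B_def mult.commute)
  have B_nonneg: "B u u \<ge> 0" for u
    by (simp add: B_def sum_nonneg)
  have bdd: "bdd_below ((\<lambda>y. B (y - x) (y - x)) ` K)"
    using B_nonneg by (intro bdd_belowI2[where m = 0]) auto
  \<comment> \<open>A point of \<open>K\<close> lies outside the neighbourhood of \<open>x\<close>,
    so a single summand already reaches \<open>d\<^sup>2\<close>.\<close>
  have "d\<^sup>2 \<le> B (y - x) (y - x)" if "y \<in> K" for y
  proof -
    obtain f where f: "f \<in> G" "d \<le> \<bar>blinfun_apply f (y - x)\<bar>"
    proof -
      have "y \<notin> {y. \<forall>f\<in>G. \<bar>blinfun_apply f (y - x)\<bar> < d}"
        using G(4) \<open>y \<in> K\<close> by blast
      then show thesis
        using that by (auto simp only: mem_Collect_eq not_less ball_simps)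
    qed
    then have "d\<^sup>2 \<le> blinfun_apply f (y - x) * blinfun_apply f (y - x)"
      using power_mono[OF f(2), of 2] G(3) by (simp add: power2_eq_square)
    also have "\<dots> \<le> B (y - x) (y - x)"
      unfolding B_def using f(1) G(1)
      by (intro member_le_sum[where f = "\<lambda>f. blinfun_apply f (y - x) * blinfun_apply f (y - x)"]) auto
    finally show ?thesis .
  qed
  then have "d\<^sup>2 \<le> m"
    unfolding m_def using K(1) by (intro cINF_greatest)
  then have m: "m > 0" using G(3) by (smt (verit) zero_less_power)
  have m_le: "m \<le> B (y - x) (y - x)" if "y \<in> K" for y
    unfolding m_def using bdd that by (rule cINF_lower)
  obtain R where R: "\<And>y z. y \<in> K \<Longrightarrow> z \<in> K \<Longrightarrow> norm (y - z) \<le> R"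
    using K(3) by (metis bounded_two_points dist_norm)
  \<comment> \<open>Boundedness of \<open>K\<close> enters here: \<open>M\<close> controls the
    quadratic term when moving from one point of \<open>K\<close> towards another.\<close>
  define M where "M = (\<Sum>f\<in>G. (norm f * R) * (norm f * R))"
  have M_nonneg: "M \<ge> 0" by (simp add: M_def sum_nonneg)
  have B_le: "B (y - z) (y - z) \<le> M" if "y \<in> K" "z \<in> K" for y z
    unfolding B_def M_def
  proof (rule sum_mono)
    fix f assume "f \<in> G"
    have "\<bar>blinfun_apply f (y - z)\<bar> \<le> norm f * R"
      using norm_blinfun[of f "y - z"] mult_left_mono[OF R[OF that], of "norm f"] by simp
    then show "blinfun_apply f (y - z) * blinfun_apply f (y - z) \<le> norm f * R * (norm f * R)"
      using mult_mono'[of "\<bar>blinfun_apply f (y - z)\<bar>" "norm f * R"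
          "\<bar>blinfun_apply f (y - z)\<bar>" "norm f * R"]
      by (simp only: abs_mult_self_eq abs_ge_zero)
  qed
  \<comment> \<open>The step length: \<open>s \<le> 1\<close> keeps the moved point in
    \<open>K\<close>, and \<open>s * (1 + M) \<le> m\<close> absorbs both the quadratic term and the
    error \<open>s * s\<close> allowed for the almost minimiser \<open>k\<close>.\<close>
  define s where "s = min 1 (m / (1 + M))"
  have "1 + M > 0" using M_nonneg by simp
  then have "s > 0" using m by (simp add: s_def)
  have "s \<le> m / (1 + M)" "s \<le> 1" by (simp_all add: s_def)
  with \<open>1 + M > 0\<close> have "s * (1 + M) \<le> m"
    by (simp only: pos_le_divide_eq)
  note s = \<open>s > 0\<close> this
  have "m < m + s * s" using s by simp
  then obtain k where k: "k \<in> K" "B (k - x) (k - x) < m + s * s"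
    using cINF_less_iff[OF K(1) bdd, of "m + s * s"] unfolding m_def by blast
  \<comment> \<open>Moving from \<open>k\<close> towards \<open>y\<close> by \<open>s\<close> cannot
    bring \<open>q\<close> below \<open>m\<close>. Expanding and dividing by \<open>s\<close> gives
    \<open>2 * B (y - k) (k - x) \<ge> - m\<close>; adding \<open>q k \<ge> m\<close> leaves at
    least \<open>m / 2\<close>.\<close>
  have sep: "B (y - x) (k - x) \<ge> m / 2" if y: "y \<in> K" for y
  proof -
    have "k + s *\<^sub>R (y - k) \<in> K"
      using convexD[OF K(4) k(1) y, of "1 - s" s] s \<open>s \<le> 1\<close> by (simp add: algebra_simps)
    from m_le[OF this] have "m \<le> B (k + s *\<^sub>R (y - k) - x) (k + s *\<^sub>R (y - k) - x)" .
    also have "k + s *\<^sub>R (y - k) - x = (k - x) + s *\<^sub>R (y - k)" by simp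
    also have "B \<dots> \<dots> = B (k - x) (k - x) + 2 * s * B (y - k) (k - x) + s * s * B (y - k) (y - k)"
      using B_sym[of "k - x" "k - x + s *\<^sub>R (y - k)"]
        B_sym[of "y - k" "k - x + s *\<^sub>R (y - k)"] B_sym[of "k - x" "y - k"]
      by (simp only: B_add B_scale) (simp only: algebra_simps mult_2)
    also have "\<dots> \<le> (m + s * s) + 2 * s * B (y - k) (k - x) + s * s * M"
      using k(2) mult_left_mono[OF B_le[OF y k(1)], of "s * s"] by simp
    finally have "0 \<le> s * (s * (1 + M) + 2 * B (y - k) (k - x))"
      by (simp add: algebra_simps)
    then have "0 \<le> s * (1 + M) + 2 * B (y - k) (k - x)"
      using s(1) by (simp add: zero_le_mult_iff)
    moreover have "B (y - x) (k - x) = B (y - k) (k - x) + B (k - x) (k - x)"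
      using B_add[of "y - k" "k - x" "k - x"] by simp
    ultimately show ?thesis
      using s(2) m_le[OF k(1)] by linarith
  qed
  define f where "f = (\<Sum>g\<in>G. (- blinfun_apply g (k - x)) *\<^sub>R g)"
  have f_apply: "blinfun_apply f u = - B u (k - x)" for u
    by (simp add: f_def B_def blinfun.sum_left blinfun.scaleR_left blinfun.minus_left sum_negf mult.commute)
  show thesis
  proof
    show "f \<in> F"
      unfolding f_def using G(2) assms(1) by (intro subspace_sum subspace_scale) auto
    show "m / 2 > 0" using m by simp
    fix y assume "y \<in> K"
    from sep[OF this] have "blinfun_apply f (y - x) \<le> - m / 2"
      by (simp add: f_apply)
    then show "blinfun_apply f y + m / 2 \<le> blinfun_apply f x"
      by (simp add: blinfun.diff_right)
  qed
qed

section \<open>Farthest distances and farthest points\<close>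

lemma norm_le_farthest_dist:
  assumes "bounded K" "z \<in> K"
  shows "norm (z - x) \<le> farthest_dist K x"
  unfolding farthest_dist_def
proof (rule cSUP_upper[OF assms(2)])
  obtain r where "\<And>z. z \<in> K \<Longrightarrow> dist x z \<le> r"
    using assms(1) bounded_any_center by metis
  then show "bdd_above ((\<lambda>z. norm (z - x)) ` K)"
    by (intro bdd_aboveI2[where M = r]) (simp add: dist_norm norm_minus_commute)
qed

lemma farthest_dist_le:
  assumes "K \<noteq> {}" "\<And>z. z \<in> K \<Longrightarrow> norm (z - x) \<le> r"
  shows "farthest_dist K x \<le> r"
  unfolding farthest_dist_def using assms by (intro cSUP_least)

lemma farthest_points_iff:
  "z \<in> farthest_points K \<longleftrightarrow> z \<in> K \<and> (\<exists>x. norm (z - x) = farthest_dist K x)"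
  by (auto simp: farthest_points_def farthest_dom_def farthest_set_def)

text \<open>Move from \<open>k\<close> by \<epsilon> directly away from \<open>x\<close>. If
  \<open>k = x\<close>, every direction serves, and \<open>v\<close> supplies one.\<close>

lemma farther_point_in_cball:
  fixes v k x :: "'a::real_normed_vector"
  assumes "v \<noteq> 0" "\<epsilon> \<ge> 0"
  obtains z where "z \<in> cball k \<epsilon>" "norm (z - x) = norm (k - x) + \<epsilon>"
proof -
  define w where "w = (if k = x then v else k - x)"
  have w: "norm w > 0" using assms(1) by (simp add: w_def)
  have "norm (k - x + (\<epsilon> / norm w) *\<^sub>R w) = norm (k - x) + \<epsilon>"
  proof (cases "k = x")
    case True
    then show ?thesis using w assms(2) by simp
  next
    case False
    then have "w = k - x" by (simp add: w_def)
    then have "k - x + (\<epsilon> / norm w) *\<^sub>R w = (1 + \<epsilon> / norm w) *\<^sub>R w"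
      by (simp only: scaleR_left_distrib scaleR_one)
    also have "norm \<dots> = (1 + \<epsilon> / norm w) * norm w"
      using w assms(2) by simp
    also have "\<dots> = norm w + \<epsilon>"
      using w by (simp add: distrib_right)
    finally show ?thesis by (simp only: \<open>w = k - x\<close>)
  qed
  then have "norm (k + (\<epsilon> / norm w) *\<^sub>R w - x) = norm (k - x) + \<epsilon>"
    by (simp add: algebra_simps)
  moreover have "k + (\<epsilon> / norm w) *\<^sub>R w \<in> cball k \<epsilon>"
    using w assms(2) by (simp add: dist_norm)
  ultimately show thesis using that by blast
qed

section \<open>From hulls of farthest points to Property (R) and the F-MIP\<close>

lemma property_R_if_closed_hull_farthest:
  assumes "subspace F" "norming F" "sigma_cbc F K"
    and "K = sigma_top F closure_of (convex hull (farthest_points K))"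
  shows "property_R K"
  unfolding property_R_def
proof (intro allI impI notI)
  fix x and \<alpha> :: real
  assume "\<alpha> > 0" and "crescent K x \<alpha> \<inter> farthest_points K = {}"
  \<comment> \<open>The radius may be negative; the ball is then empty and the argument goes through
    unchanged.\<close>
  then have "farthest_points K \<subseteq> cball x (farthest_dist K x - \<alpha>)"
    by (fastforce simp: crescent_def farthest_points_iff dist_norm norm_minus_commute)
  then have "sigma_top F closure_of (convex hull (farthest_points K))
      \<subseteq> cball x (farthest_dist K x - \<alpha>)"
    by (intro sigma_closed_hull_minimal closedin_sigma_top_cball assms) auto
  with assms(4) have "K \<subseteq> cball x (farthest_dist K x - \<alpha>)" by simp
  then have "farthest_dist K x \<le> farthest_dist K x - \<alpha>"
    using assms(3)
    by (intro farthest_dist_le) (auto simp: sigma_cbc_def dist_norm norm_minus_commute)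
  with \<open>\<alpha> > 0\<close> show False by simp
qed

lemma admissible_set_if_closed_hull_farthest:
  fixes F :: "('a::real_normed_vector \<Rightarrow>\<^sub>L real) set"
  assumes "subspace F" "norming F" "sigma_cbc F K"
    and hull: "\<And>L. sigma_cbc F L \<Longrightarrow> L = sigma_top F closure_of (convex hull (farthest_points L))"
  shows "admissible_set K"
proof -
  have F: "F \<noteq> {}" using assms(1) subspace_0 by blast
  have K: "K \<noteq> {}" "bounded K" using assms(3) by (auto simp: sigma_cbc_def)
  have "x0 \<in> K" if x0: "\<And>c r. K \<subseteq> cball c r \<Longrightarrow> x0 \<in> cball c r" for x0
  proof (rule ccontr)
    assume "x0 \<notin> K"
    then obtain f \<gamma> where f: "f \<in> F" "\<gamma> > 0"
      "\<And>y. y \<in> K \<Longrightarrow> blinfun_apply f y + \<gamma> \<le> blinfun_apply f x0"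
      using sigma_separation[OF assms(1,3)] by metis
    \<comment> \<open>Small enough that a shift by \<epsilon> raises \<open>f\<close> by less than
      \<gamma>; the \<open>+ 1\<close> keeps the denominator positive.\<close>
    define \<epsilon> where "\<epsilon> = \<gamma> / (norm f + 1)"
    have pos: "norm f + 1 > 0" by (simp add: add_nonneg_pos)
    then have \<epsilon>: "\<epsilon> > 0" "norm f * \<epsilon> < \<gamma>"
      using f(2) by (auto simp: \<epsilon>_def field_simps)
    define c where "c = blinfun_apply f x0 - \<gamma> + norm f * \<epsilon>"
    have c: "c < blinfun_apply f x0" using \<epsilon> by (simp add: c_def)
    \<comment> \<open>The weight that balances the two kinds of points:
      \<open>r + t * f x0 = r + \<epsilon> + t * c\<close>, so \<open>x0\<close>, nearer to
      \<open>x\<close> but higher under \<open>f\<close>, obeys the same bound as the enlargement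
      \<open>A\<close>.\<close>
    define t where "t = \<epsilon> / (blinfun_apply f x0 - c)"
    have t: "t > 0" "t * (blinfun_apply f x0 - c) = \<epsilon>" using \<epsilon> c by (auto simp: t_def)
    define A where "A = (\<Union>k\<in>K. cball k \<epsilon>)"
    define L where "L = sigma_top F closure_of (convex hull (insert x0 A))"
    have fA: "blinfun_apply f z \<le> c" if "z \<in> A" for z
    proof -
      obtain k where k: "k \<in> K" "norm (z - k) \<le> \<epsilon>"
        using \<open>z \<in> A\<close> by (auto simp: A_def dist_norm norm_minus_commute)
      have "blinfun_apply f (z - k) \<le> norm f * \<epsilon>"
        using blinfun_apply_le_norm[of f "z - k"] mult_left_mono[OF k(2), of "norm f"] by simp
      with f(3)[OF k(1)] show ?thesis by (simp add: c_def blinfun.diff_right)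
    qed
    have "bounded A"
    proof -
      obtain r where r: "\<And>k. k \<in> K \<Longrightarrow> norm k \<le> r" using K(2) by (auto simp: bounded_iff)
      have "norm z \<le> r + \<epsilon>" if "z \<in> A" for z
      proof -
        obtain k where k: "k \<in> K" "norm (z - k) \<le> \<epsilon>"
          using \<open>z \<in> A\<close> by (auto simp: A_def dist_norm norm_minus_commute)
        then show ?thesis using r[OF k(1)] norm_triangle_sub[of z k] by simp
      qed
      then show ?thesis by (auto simp: bounded_iff)
    qed
    then have L: "sigma_cbc F L"
      unfolding L_def by (intro sigma_cbc_closed_hull assms) auto
    then have "bounded L" by (simp add: sigma_cbc_def)
    have AL: "insert x0 A \<subseteq> L"
      unfolding L_def by (rule subset_sigma_closed_hull[OF F])
    have "blinfun_apply f z \<le> c" if z: "z \<in> farthest_points L" for z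
    proof -
      obtain x where x: "z \<in> L" "norm (z - x) = farthest_dist L x"
        using z by (auto simp: farthest_points_iff)
      define r where "r = farthest_dist K x"
      have Kr: "norm (k - x) \<le> r" if "k \<in> K" for k
        unfolding r_def using norm_le_farthest_dist[OF K(2) that] .
      then have "norm (x0 - x) \<le> r"
        using x0[of x r] by (auto simp: dist_norm norm_minus_commute subset_iff)
      \<comment> \<open>Each \<open>k\<close> in \<open>K\<close> can be pushed away from
        \<open>x\<close> by \<epsilon> without leaving \<open>A\<close>; the nonzero vector
        \<open>x0 - k\<close> covers the case \<open>k = x\<close>.\<close>
      have "r \<le> farthest_dist L x - \<epsilon>"
        unfolding r_def
      proof (rule farthest_dist_le[OF K(1)])
        fix k assume k: "k \<in> K"
        then have "x0 - k \<noteq> 0" using \<open>x0 \<notin> K\<close> by auto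
        then obtain y where y: "y \<in> cball k \<epsilon>" "norm (y - x) = norm (k - x) + \<epsilon>"
          using farther_point_in_cball \<epsilon>(1) by (metis less_imp_le)
        then have "y \<in> A" using k by (auto simp: A_def)
        then have "y \<in> L" using AL by blast
        from norm_le_farthest_dist[OF \<open>bounded L\<close> this, of x] y(2)
        show "norm (k - x) \<le> farthest_dist L x - \<epsilon>" by simp
      qed
      \<comment> \<open>A \<sigma>-closed convex set containing \<open>x0\<close> and
        \<open>A\<close>, hence \<open>L\<close>. At the farthest point \<open>z\<close> the norm
        term is at least \<open>r + \<epsilon>\<close>, which leaves
        \<open>t * f z \<le> t * c\<close>.\<close>
      define S where "S = {y. norm (y - x) + blinfun_apply (t *\<^sub>R f) y \<le> r + \<epsilon> + t * c}"
      have "x0 \<in> S"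
        using \<open>norm (x0 - x) \<le> r\<close> t by (simp add: S_def blinfun.scaleR_left algebra_simps)
      moreover have "y \<in> S" if "y \<in> A" for y
      proof -
        obtain k where k: "k \<in> K" "norm (y - k) \<le> \<epsilon>"
          using \<open>y \<in> A\<close> by (auto simp: A_def dist_norm norm_minus_commute)
        have "norm (y - x) \<le> r + \<epsilon>"
          using norm_triangle_ineq[of "y - k" "k - x"] k(2) Kr[OF k(1)] by simp
        moreover have "t * blinfun_apply f y \<le> t * c"
          using fA[OF that] t(1) by simp
        ultimately show ?thesis by (simp add: S_def blinfun.scaleR_left)
      qed
      ultimately have "L \<subseteq> S"
        unfolding L_def S_def using assms(1) f(1)
        by (intro sigma_closed_hull_minimal convex_norm_plus_sublevel
            closedin_sigma_top_norm_plus_sublevel assms(1,2) subspace_scale) auto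
      with x \<open>r \<le> farthest_dist L x - \<epsilon>\<close> have "t * blinfun_apply f z \<le> t * c"
        by (auto simp: S_def blinfun.scaleR_left)
      with t(1) show ?thesis by simp
    qed
    then have "sigma_top F closure_of (convex hull (farthest_points L))
        \<subseteq> {y. blinfun_apply f y \<le> c}"
    proof (intro sigma_closed_hull_minimal closedin_sigma_top_halfspace f(1))
      show "convex {y. blinfun_apply f y \<le> c}"
        by (intro convexI)
          (simp add: blinfun.add_right blinfun.scaleR_right convex_bound_le)
    qed auto
    with hull[OF L] AL c show False by force
  qed
  then show ?thesis
    unfolding admissible_set_def by blast
qed

section \<open>The converse, and the equivalence\<close>

lemma closed_hull_farthest_if_MIP:
  assumes "subspace F" "norming F" "has_MIP F" "property_R K" "sigma_cbc F K"
  shows "K = sigma_top F closure_of (convex hull (farthest_points K))"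
proof
  have F: "F \<noteq> {}" using assms(1) subspace_0 by blast
  have K: "bounded K" "convex K" "closedin (sigma_top F) K"
    using assms(5) by (auto simp: sigma_cbc_def)
  define L where "L = sigma_top F closure_of (convex hull (farthest_points K))"
  have bK: "farthest_points K \<subseteq> K" by (auto simp: farthest_points_iff)
  show "sigma_top F closure_of (convex hull (farthest_points K)) \<subseteq> K"
    using bK K by (intro sigma_closed_hull_minimal)
  \<comment> \<open>Property (R) makes \<open>L\<close> nonempty, as is required to apply the F-MIP
    to it.\<close>
  have "farthest_points K \<noteq> {}"
    using assms(4) zero_less_one unfolding property_R_def by blast
  then have "sigma_cbc F L"
    unfolding L_def using bounded_subset[OF K(1) bK] by (intro sigma_cbc_closed_hull assms)
  then have adm: "L = \<Inter>{B. (\<exists>c r. B = cball c r) \<and> L \<subseteq> B}"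
    using assms(3) by (simp add: has_MIP_def admissible_set_def)
  show "K \<subseteq> sigma_top F closure_of (convex hull (farthest_points K))"
  proof (rule ccontr)
    assume "\<not> ?thesis"
    then obtain x0 where x0: "x0 \<in> K" "x0 \<notin> L" by (auto simp: L_def)
    then obtain c r where B: "L \<subseteq> cball c r" "x0 \<notin> cball c r"
      using adm by blast
    \<comment> \<open>With this number as \<alpha>, the crescent is exactly the part of
      \<open>K\<close> outside \<open>cball c r\<close>, while all farthest points lie
      inside.\<close>
    then have "farthest_dist K c - r > 0"
      using norm_le_farthest_dist[OF K(1) x0(1), of c] by (simp add: dist_norm norm_minus_commute)
    then obtain b where "b \<in> crescent K c (farthest_dist K c - r)" "b \<in> farthest_points K"
      using assms(4) unfolding property_R_def by blast
    moreover from this have "b \<in> cball c r"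
      using B(1) subset_sigma_closed_hull[OF F, of "farthest_points K"] by (auto simp: L_def)
    ultimately show False
      by (simp add: crescent_def dist_norm norm_minus_commute)
  qed
qed

theorem theorem2:
  fixes F :: "('a::banach \<Rightarrow>\<^sub>L real) set"
  assumes "subspace F" and "norming F"
  shows "(\<forall>K. sigma_cbc F K \<longrightarrow> K = sigma_top F closure_of (convex hull (farthest_points K)))
     \<longleftrightarrow> (has_MIP F \<and> (\<forall>K. sigma_cbc F K \<longrightarrow> property_R K))"
proof (intro iffI conjI allI impI; (elim conjE)?)
  assume hull: "\<forall>K. sigma_cbc F K \<longrightarrow> K = sigma_top F closure_of (convex hull (farthest_points K))"
  show "has_MIP F"
    unfolding has_MIP_def
    using admissible_set_if_closed_hull_farthest[OF assms] hull by blast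
  fix K assume "sigma_cbc F K"
  then show "property_R K"
    using property_R_if_closed_hull_farthest[OF assms] hull by blast
next
  fix K assume "has_MIP F" "\<forall>K. sigma_cbc F K \<longrightarrow> property_R K" "sigma_cbc F K"
  then show "K = sigma_top F closure_of (convex hull (farthest_points K))"
    using closed_hull_farthest_if_MIP[OF assms] by blast
qed

end
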